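(* Let $(\Omega,\mathcal A,P)$ be a probability space, let $(\Omega_i,\mathcal A_i)$, $i=1,2,3$, be measurable spaces, and let $X_i:(\Omega,\mathcal A,P)\to(\Omega_i,\mathcal A_i)$, $i=1,2,3$, be random variables such that the conditional distributions $P^{X_1|X_3}$, $P^{X_2|X_3}$ and $P^{(X_1,X_2)|X_3}$ exist. Suppose that $X_1$ and $X_2$ are conditionally independent given $X_3$. Then $X_1$ and $X_2$ are independent (with respect to $P$) if, and only if, the Markov kernels $P^{X_1|X_3}:(\Omega_3,\mathcal A_3,P^{X_3})\to(\Omega_1,\mathcal A_1)$ and $P^{X_2|X_3}:(\Omega_3,\mathcal A_3,P^{X_3})\to(\Omega_2,\mathcal A_2)$ are $P^{X_3}$-independent.
   Context: A random variable is a measurable map between measurable spaces. For a random variable $X:(\Omega,\mathcal A)\to(\Omega_1,\mathcal A_1)$ and a probability measure $P$ on $\mathcal A$, $P^X$ denotes the distribution $P^X(A_1)=P(X^{-1}(A_1))$. The symbol $\times$ denotes products of $\sigma$-fields and of measures. Markov kernel: a Markov kernel $M$ from $(\Omega,\mathcal A)$ to $(\Omega_1,\mathcal A_1)$ is a map $M:\Omega\times\mathcal A_1\to[0,1]$ such that $M(\omega,\cdot)$ is a probability measure on $\mathcal A_1$ for every $\omega\in\Omega$ and $M(\cdot,A_1)$ is $\mathcal A$-measurable for every $A_1\in\mathcal A_1$. Diagonal product: for Markov kernels $M_1$ from $(\Omega,\mathcal A)$ to $(\Omega_1,\mathcal A_1)$ and $M_2$ from $(\Omega,\mathcal A)$ to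 $(\Omega_2,\mathcal A_2)$, $M_1\times M_2$ is the unique Markov kernel from $(\Omega,\mathcal A)$ to $(\Omega_1\times\Omega_2,\mathcal A_1\times\mathcal A_2)$ with $(M_1\times M_2)(\omega,A_1\times A_2)=M_1(\omega,A_1)\,M_2(\omega,A_2)$ for all $A_i\in\mathcal A_i$. Image of a kernel: for a probability measure $Q$ on $\mathcal A$ and a Markov kernel $M$ from $(\Omega,\mathcal A)$ to $(\Omega_1,\mathcal A_1)$, $Q^{M}(A_1):=\int_\Omega M(\omega,A_1)\,dQ(\omega)$, $A_1\in\mathcal A_1$. Independence of kernels: two Markov kernels $M_1,M_2$ on $(\Omega,\mathcal A,Q)$ are ($Q$-)independent if $Q^{M_1\times M_2}=Q^{M_1}\times Q^{M_2}$. Conditional distribution: for random variables $X,Y$ on $(\Omega,\mathcal A,P)$ with values in $(\Omega_X,\mathcal A_X)$ and $(\Omega_Y,\mathcal A_Y)$, the conditional distribution $P^{Y|X}$ of $Y$ given $X$, when it exists, is a Markov kernel from $(\Omega_X,\mathcal A_X)$ to $(\Omega_Y,\mathcal A_Y)$, written $P^{Y|X=x}(B)$, such that $P(X\in A,Y\in B)=\int_A P^{Y|X=x}(B)\,dP^X(x)$ for all $A\in\mathcal A_X$, $B\in\mathcal A_Y$. Conditional independence: $X_1$ and $X_2$ are conditionally independent given $X_3$ if $P^{(X_1,X_2)|X_3}=P^{X_1|X_3}\times P^{X_2|X_3}$, $P^{X_3}$-almost surely; that is, for all $A_i\in\mathcal A_i$, $1\le i\le 3$, $\int_{A_3}P^{(X_1,X_2)|X_3=\omega_3}(A_1\times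 A_2)\,dP^{X_3}(\omega_3)=\int_{A_3}P^{X_1|X_3=\omega_3}(A_1)\,P^{X_2|X_3=\omega_3}(A_2)\,dP^{X_3}(\omega_3)$. *)

theory Defs
  imports "HOL-Probability.Probability"
begin

text \<open>
  A kernel is curried: \<open>K \<omega>\<close> is the measure \<open>K(\<omega>, \<cdot>)\<close>. Its values outside
  \<open>space M\<close> are irrelevant.
\<close>

definition markov_kernel :: "'a measure \<Rightarrow> 'b measure \<Rightarrow> ('a \<Rightarrow> 'b measure) \<Rightarrow> bool" where
  "markov_kernel M N K \<longleftrightarrow> K \<in> M \<rightarrow>\<^sub>M prob_algebra N"

lemma markov_kernel_iff:
  "markov_kernel M N K \<longleftrightarrow>
    (\<forall>\<omega>\<in>space M. prob_space (K \<omega>) \<and> sets (K \<omega>) = sets N) \<and>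
    (\<forall>B\<in>sets N. (\<lambda>\<omega>. emeasure (K \<omega>) B) \<in> borel_measurable M)"
proof
  assume K: "markov_kernel M N K"
  then have "K \<in> M \<rightarrow>\<^sub>M subprob_algebra N"
    unfolding markov_kernel_def by (rule measurable_prob_algebraD)
  then have "\<forall>B\<in>sets N. (\<lambda>\<omega>. emeasure (K \<omega>) B) \<in> borel_measurable M"
    by (auto intro: measurable_emeasure_kernel)
  moreover have "\<forall>\<omega>\<in>space M. prob_space (K \<omega>) \<and> sets (K \<omega>) = sets N"
    using measurable_space[OF K[unfolded markov_kernel_def]] by (simp add: space_prob_algebra)
  ultimately show "(\<forall>\<omega>\<in>space M. prob_space (K \<omega>) \<and> sets (K \<omega>) = sets N) \<and>
    (\<forall>B\<in>sets N. (\<lambda>\<omega>. emeasure (K \<omega>) B) \<in> borel_measurable M)" by blast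
next
  assume "(\<forall>\<omega>\<in>space M. prob_space (K \<omega>) \<and> sets (K \<omega>) = sets N) \<and>
    (\<forall>B\<in>sets N. (\<lambda>\<omega>. emeasure (K \<omega>) B) \<in> borel_measurable M)"
  then show "markov_kernel M N K"
    unfolding markov_kernel_def
    by (intro measurable_prob_algebraI measurable_subprob_algebra)
       (auto intro: prob_space_imp_subprob_space)
qed

definition kernel_prod ::
  "('a \<Rightarrow> 'b measure) \<Rightarrow> ('a \<Rightarrow> 'c measure) \<Rightarrow> 'a \<Rightarrow> ('b \<times> 'c) measure" where
  "kernel_prod K\<^sub>1 K\<^sub>2 = (\<lambda>\<omega>. K\<^sub>1 \<omega> \<Otimes>\<^sub>M K\<^sub>2 \<omega>)"

lemma markov_kernel_prod:
  assumes "markov_kernel M N\<^sub>1 K\<^sub>1" "markov_kernel M N\<^sub>2 K\<^sub>2"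
  shows "markov_kernel M (N\<^sub>1 \<Otimes>\<^sub>M N\<^sub>2) (kernel_prod K\<^sub>1 K\<^sub>2)"
  using assms unfolding markov_kernel_def kernel_prod_def
  by measurable

lemma emeasure_kernel_prod:
  assumes "markov_kernel M N\<^sub>1 K\<^sub>1" "markov_kernel M N\<^sub>2 K\<^sub>2"
    and "\<omega> \<in> space M" "A \<in> sets N\<^sub>1" "B \<in> sets N\<^sub>2"
  shows "emeasure (kernel_prod K\<^sub>1 K\<^sub>2 \<omega>) (A \<times> B) = emeasure (K\<^sub>1 \<omega>) A * emeasure (K\<^sub>2 \<omega>) B"
proof -
  interpret K2: prob_space "K\<^sub>2 \<omega>"
    using assms by (simp add: markov_kernel_iff)
  show ?thesis
    using assms by (simp add: kernel_prod_def markov_kernel_iff K2.emeasure_pair_measure_Times)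
qed

text \<open>The image \<open>Q\<^sup>K\<close> is the Giry monad bind:\<close>

definition kernel_image :: "'a measure \<Rightarrow> ('a \<Rightarrow> 'b measure) \<Rightarrow> 'b measure" where
  "kernel_image Q K = Q \<bind> K"

lemma emeasure_kernel_image:
  assumes "prob_space Q" "markov_kernel Q N K" "A \<in> sets N"
  shows "emeasure (kernel_image Q K) A = (\<integral>\<^sup>+\<omega>. emeasure (K \<omega>) A \<partial>Q)"
  unfolding kernel_image_def
  using assms by (intro emeasure_bind)
    (auto simp: markov_kernel_def prob_space.not_empty intro: measurable_prob_algebraD)

lemma sets_kernel_image:
  assumes "prob_space Q" "markov_kernel Q N K"
  shows "sets (kernel_image Q K) = sets N"
  unfolding kernel_image_def
  using assms by (intro sets_bind) (auto simp: markov_kernel_iff prob_space.not_empty)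

definition kernel_indep ::
  "'a measure \<Rightarrow> ('a \<Rightarrow> 'b measure) \<Rightarrow> ('a \<Rightarrow> 'c measure) \<Rightarrow> bool" where
  "kernel_indep Q K\<^sub>1 K\<^sub>2 \<longleftrightarrow>
    kernel_image Q (kernel_prod K\<^sub>1 K\<^sub>2) = kernel_image Q K\<^sub>1 \<Otimes>\<^sub>M kernel_image Q K\<^sub>2"

text \<open>
  \<open>cond_distr P N Y M X K\<close>: the kernel \<open>K\<close> is a version of the conditional distribution
  of \<open>Y\<close> (values in \<open>N\<close>) given \<open>X\<close> (values in \<open>M\<close>).
\<close>

definition cond_distr ::
  "'w measure \<Rightarrow> 'b measure \<Rightarrow> ('w \<Rightarrow> 'b) \<Rightarrow> 'a measure \<Rightarrow> ('w \<Rightarrow> 'a) \<Rightarrow> ('a \<Rightarrow> 'b measure) \<Rightarrow> bool" where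
  "cond_distr P N Y M X K \<longleftrightarrow>
    markov_kernel M N K \<and>
    (\<forall>A\<in>sets M. \<forall>B\<in>sets N.
      emeasure P {\<omega> \<in> space P. X \<omega> \<in> A \<and> Y \<omega> \<in> B} =
      (\<integral>\<^sup>+x\<in>A. emeasure (K x) B \<partial>distr P M X))"

text \<open>
  Conditional independence given a variable with distribution \<open>Q\<close>, in terms of versions
  \<open>K\<^sub>1\<close>, \<open>K\<^sub>2\<close>, \<open>K\<^sub>1\<^sub>2\<close> of the conditional distributions of the two variables and of the pair.
  The almost sure equality of kernels is meant rectangle by rectangle, the exceptional null set
  depending on the rectangle.
\<close>

definition cond_indep ::
  "'c measure \<Rightarrow> 'a measure \<Rightarrow> 'b measure \<Rightarrow>
    ('c \<Rightarrow> 'a measure) \<Rightarrow> ('c \<Rightarrow> 'b measure) \<Rightarrow> ('c \<Rightarrow> ('a \<times> 'b) measure) \<Rightarrow> bool" where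
  "cond_indep Q M\<^sub>1 M\<^sub>2 K\<^sub>1 K\<^sub>2 K\<^sub>1\<^sub>2 \<longleftrightarrow>
    (\<forall>A\<^sub>1\<in>sets M\<^sub>1. \<forall>A\<^sub>2\<in>sets M\<^sub>2. \<forall>A\<^sub>3\<in>sets Q.
      (\<integral>\<^sup>+x\<in>A\<^sub>3. emeasure (K\<^sub>1\<^sub>2 x) (A\<^sub>1 \<times> A\<^sub>2) \<partial>Q) =
      (\<integral>\<^sup>+x\<in>A\<^sub>3. emeasure (K\<^sub>1 x) A\<^sub>1 * emeasure (K\<^sub>2 x) A\<^sub>2 \<partial>Q))"

text \<open>
  The library's \<^term>\<open>prob_space.indep_var\<close> forces both variables to have the same value type.
  The following is its heterogeneous version: independence of the generated \<open>\<sigma>\<close>-fields.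
\<close>

definition indep_rv ::
  "'w measure \<Rightarrow> 'a measure \<Rightarrow> ('w \<Rightarrow> 'a) \<Rightarrow> 'b measure \<Rightarrow> ('w \<Rightarrow> 'b) \<Rightarrow> bool" where
  "indep_rv P M\<^sub>1 X\<^sub>1 M\<^sub>2 X\<^sub>2 \<longleftrightarrow>
    prob_space.indep_set P {X\<^sub>1 -` A \<inter> space P | A. A \<in> sets M\<^sub>1} {X\<^sub>2 -` A \<inter> space P | A. A \<in> sets M\<^sub>2}"

lemma indep_rv_eq_indep_var:
  assumes "prob_space P" and X: "X \<in> P \<rightarrow>\<^sub>M M" and Y: "Y \<in> P \<rightarrow>\<^sub>M N"
  shows "indep_rv P M X N Y \<longleftrightarrow> prob_space.indep_var P M X N Y"
proof -
  interpret prob_space P by fact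
  have "sigma_sets (space P) {X -` A \<inter> space P | A. A \<in> sets M} = {X -` A \<inter> space P | A. A \<in> sets M}"
    using sets_vimage_algebra[of "space P" X M] sets_vimage_algebra2[of X "space P" M]
      measurable_space[OF X] by auto
  moreover have "sigma_sets (space P) {Y -` A \<inter> space P | A. A \<in> sets N} = {Y -` A \<inter> space P | A. A \<in> sets N}"
    using sets_vimage_algebra[of "space P" Y N] sets_vimage_algebra2[of Y "space P" N]
      measurable_space[OF Y] by auto
  ultimately show ?thesis
    using X Y by (simp add: indep_rv_def indep_var_eq)
qed

end

theory Submission
  imports Defs
begin

text \<open>
  Both sides of the equivalence say that the joint law of \<open>X\<^sub>1\<close> and \<open>X\<^sub>2\<close> is a product
  on rectangles. Averaging a conditional distribution over the law of the conditioning variable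
  gives back the unconditional law, so \<open>K\<^sub>1\<close>, \<open>K\<^sub>2\<close> and \<open>K\<^sub>1\<^sub>2\<close> have as images the laws of
  \<open>X\<^sub>1\<close>, \<open>X\<^sub>2\<close> and \<open>(X\<^sub>1, X\<^sub>2)\<close> (\<open>kernel_image_cond_distr\<close>). Conditional independence,
  integrated over all of \<open>\<Omega>\<^sub>3\<close>, says that the diagonal product of \<open>K\<^sub>1\<close> and \<open>K\<^sub>2\<close> has on
  rectangles the same image as \<open>K\<^sub>1\<^sub>2\<close> (\<open>cond_indep_emeasure_kernel_image\<close>). Hence the factorization
  of the image of the product kernel, which is kernel independence (\<open>kernel_indep_iff\<close>),
  is the factorization \<open>P(X\<^sub>1 \<in> A, X\<^sub>2 \<in> B) = P(X\<^sub>1 \<in> A) P(X\<^sub>2 \<in> B)\<close>, which is independence of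
  the variables (\<open>indep_rv_iff_distr\<close>).
\<close>

lemma markov_kernel_cong_sets:
  assumes "sets M = sets M'"
  shows "markov_kernel M N K \<longleftrightarrow> markov_kernel M' N K"
  using assms by (simp add: markov_kernel_def cong: measurable_cong_sets)

lemma prob_space_kernel_image:
  assumes "prob_space Q" "markov_kernel Q N K"
  shows "prob_space (kernel_image Q K)"
proof -
  have "K \<in> Q \<rightarrow>\<^sub>M subprob_algebra N"
    using assms(2) unfolding markov_kernel_def by (rule measurable_prob_algebraD)
  moreover have "AE \<omega> in Q. prob_space (K \<omega>)"
    using assms(2) by (intro AE_I2) (simp add: markov_kernel_iff)
  ultimately show ?thesis
    unfolding kernel_image_def by (intro prob_space.prob_space_bind[OF assms(1)])
qed

text \<open>
  The law of total probability: conditioning on the sure event \<open>X \<in> space M\<close> imposes nothing on \<open>Y\<close>.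
\<close>

lemma kernel_image_cond_distr:
  assumes "prob_space P" and X: "X \<in> P \<rightarrow>\<^sub>M M" and Y: "Y \<in> P \<rightarrow>\<^sub>M N"
    and K: "cond_distr P N Y M X K"
  shows "kernel_image (distr P M X) K = distr P N Y"
proof (rule measure_eqI)
  interpret P: prob_space P by fact
  have Q: "prob_space (distr P M X)"
    using X by (rule P.prob_space_distr)
  have mk: "markov_kernel (distr P M X) N K"
    using K by (simp add: cond_distr_def markov_kernel_cong_sets[of "distr P M X" M])
  show "sets (kernel_image (distr P M X) K) = sets (distr P N Y)"
    by (simp add: sets_kernel_image[OF Q mk])
  fix B assume "B \<in> sets (kernel_image (distr P M X) K)"
  then have B: "B \<in> sets N"
    by (simp add: sets_kernel_image[OF Q mk])
  have "emeasure (kernel_image (distr P M X) K) B =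
      (\<integral>\<^sup>+x\<in>space M. emeasure (K x) B \<partial>distr P M X)"
    unfolding emeasure_kernel_image[OF Q mk B] by (intro nn_integral_cong) simp
  also have "\<dots> = emeasure P {\<omega> \<in> space P. X \<omega> \<in> space M \<and> Y \<omega> \<in> B}"
    using K B by (simp add: cond_distr_def)
  also have "\<dots> = emeasure (distr P N Y) B"
    using Y B measurable_space[OF X]
    by (auto simp: emeasure_distr intro!: arg_cong[where f = "emeasure P"])
  finally show "emeasure (kernel_image (distr P M X) K) B = emeasure (distr P N Y) B" .
qed

text \<open>
  The choice \<open>A\<^sub>3 = space Q\<close> in conditional independence turns the integrals into kernel images.
\<close>

lemma cond_indep_emeasure_kernel_image:
  assumes Q: "prob_space Q"
    and K1: "markov_kernel Q M\<^sub>1 K\<^sub>1" and K2: "markov_kernel Q M\<^sub>2 K\<^sub>2"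
    and K12: "markov_kernel Q (M\<^sub>1 \<Otimes>\<^sub>M M\<^sub>2) K\<^sub>1\<^sub>2"
    and indep: "cond_indep Q M\<^sub>1 M\<^sub>2 K\<^sub>1 K\<^sub>2 K\<^sub>1\<^sub>2"
    and A: "A \<in> sets M\<^sub>1" and B: "B \<in> sets M\<^sub>2"
  shows "emeasure (kernel_image Q (kernel_prod K\<^sub>1 K\<^sub>2)) (A \<times> B) =
    emeasure (kernel_image Q K\<^sub>1\<^sub>2) (A \<times> B)"
proof -
  have AB: "A \<times> B \<in> sets (M\<^sub>1 \<Otimes>\<^sub>M M\<^sub>2)"
    using A B by simp
  have "emeasure (kernel_image Q (kernel_prod K\<^sub>1 K\<^sub>2)) (A \<times> B) =
      (\<integral>\<^sup>+x\<in>space Q. emeasure (K\<^sub>1 x) A * emeasure (K\<^sub>2 x) B \<partial>Q)"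
    unfolding emeasure_kernel_image[OF Q markov_kernel_prod[OF K1 K2] AB]
    by (intro nn_integral_cong) (simp add: emeasure_kernel_prod[OF K1 K2 _ A B])
  also have "\<dots> = (\<integral>\<^sup>+x\<in>space Q. emeasure (K\<^sub>1\<^sub>2 x) (A \<times> B) \<partial>Q)"
    using indep[unfolded cond_indep_def, rule_format, OF A B sets.top] by (rule sym)
  also have "\<dots> = emeasure (kernel_image Q K\<^sub>1\<^sub>2) (A \<times> B)"
    unfolding emeasure_kernel_image[OF Q K12 AB] by (intro nn_integral_cong) simp
  finally show ?thesis .
qed

text \<open>
  Rectangles suffice because a product of \<open>\<sigma>\<close>-finite measures is determined by its values on them.
\<close>

lemma kernel_indep_iff:
  assumes Q: "prob_space Q"
    and K1: "markov_kernel Q M\<^sub>1 K\<^sub>1" and K2: "markov_kernel Q M\<^sub>2 K\<^sub>2"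
  shows "kernel_indep Q K\<^sub>1 K\<^sub>2 \<longleftrightarrow>
    (\<forall>A\<in>sets M\<^sub>1. \<forall>B\<in>sets M\<^sub>2. emeasure (kernel_image Q (kernel_prod K\<^sub>1 K\<^sub>2)) (A \<times> B) =
      emeasure (kernel_image Q K\<^sub>1) A * emeasure (kernel_image Q K\<^sub>2) B)"
proof -
  interpret I1: prob_space "kernel_image Q K\<^sub>1"
    by (rule prob_space_kernel_image[OF Q K1])
  interpret I2: prob_space "kernel_image Q K\<^sub>2"
    by (rule prob_space_kernel_image[OF Q K2])
  note [simp] = sets_kernel_image[OF Q K1] sets_kernel_image[OF Q K2]
    sets_kernel_image[OF Q markov_kernel_prod[OF K1 K2]]
  show ?thesis
  proof
    assume "kernel_indep Q K\<^sub>1 K\<^sub>2"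
    then show "\<forall>A\<in>sets M\<^sub>1. \<forall>B\<in>sets M\<^sub>2. emeasure (kernel_image Q (kernel_prod K\<^sub>1 K\<^sub>2)) (A \<times> B) =
        emeasure (kernel_image Q K\<^sub>1) A * emeasure (kernel_image Q K\<^sub>2) B"
      by (simp add: kernel_indep_def I2.emeasure_pair_measure_Times)
  next
    assume rect: "\<forall>A\<in>sets M\<^sub>1. \<forall>B\<in>sets M\<^sub>2.
      emeasure (kernel_image Q (kernel_prod K\<^sub>1 K\<^sub>2)) (A \<times> B) =
        emeasure (kernel_image Q K\<^sub>1) A * emeasure (kernel_image Q K\<^sub>2) B"
    have "kernel_image Q K\<^sub>1 \<Otimes>\<^sub>M kernel_image Q K\<^sub>2 = kernel_image Q (kernel_prod K\<^sub>1 K\<^sub>2)"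
      by (rule pair_measure_eqI[OF I1.sigma_finite_measure_axioms I2.sigma_finite_measure_axioms])
        (use rect in \<open>simp_all cong: sets_pair_measure_cong\<close>)
    then show "kernel_indep Q K\<^sub>1 K\<^sub>2"
      by (simp add: kernel_indep_def)
  qed
qed

lemma indep_rv_iff_distr:
  assumes "prob_space P" and X: "X \<in> P \<rightarrow>\<^sub>M M" and Y: "Y \<in> P \<rightarrow>\<^sub>M N"
  shows "indep_rv P M X N Y \<longleftrightarrow>
    (\<forall>A\<in>sets M. \<forall>B\<in>sets N. emeasure (distr P (M \<Otimes>\<^sub>M N) (\<lambda>\<omega>. (X \<omega>, Y \<omega>))) (A \<times> B) =
      emeasure (distr P M X) A * emeasure (distr P N Y) B)"
proof -
  interpret prob_space P by fact
  have "emeasure (distr P (M \<Otimes>\<^sub>M N) (\<lambda>\<omega>. (X \<omega>, Y \<omega>))) (A \<times> B) =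
      emeasure (distr P M X) A * emeasure (distr P N Y) B \<longleftrightarrow>
    prob ((X -` A \<inter> space P) \<inter> (Y -` B \<inter> space P)) =
      prob (X -` A \<inter> space P) * prob (Y -` B \<inter> space P)"
    if "A \<in> sets M" "B \<in> sets N" for A B
  proof -
    have "(\<lambda>\<omega>. (X \<omega>, Y \<omega>)) -` (A \<times> B) \<inter> space P = (X -` A \<inter> space P) \<inter> (Y -` B \<inter> space P)"
      by auto
    with that X Y show ?thesis
      by (simp add: emeasure_distr emeasure_eq_measure ennreal_mult'[symmetric])
  qed
  moreover have "indep_rv P M X N Y \<longleftrightarrow> (\<forall>A\<in>sets M. \<forall>B\<in>sets N.
      prob ((X -` A \<inter> space P) \<inter> (Y -` B \<inter> space P)) =
      prob (X -` A \<inter> space P) * prob (Y -` B \<inter> space P))"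
    unfolding indep_rv_def indep_sets2_eq
    using measurable_sets[OF X] measurable_sets[OF Y] by blast
  ultimately show ?thesis
    by simp
qed

theorem theorem1:
  fixes P :: "'w measure"
    and M\<^sub>1 :: "'a measure" and M\<^sub>2 :: "'b measure" and M\<^sub>3 :: "'c measure"
    and X\<^sub>1 :: "'w \<Rightarrow> 'a" and X\<^sub>2 :: "'w \<Rightarrow> 'b" and X\<^sub>3 :: "'w \<Rightarrow> 'c"
    and K\<^sub>1 :: "'c \<Rightarrow> 'a measure" and K\<^sub>2 :: "'c \<Rightarrow> 'b measure"
    and K\<^sub>1\<^sub>2 :: "'c \<Rightarrow> ('a \<times> 'b) measure"
  assumes "prob_space P"
    and "X\<^sub>1 \<in> P \<rightarrow>\<^sub>M M\<^sub>1" and "X\<^sub>2 \<in> P \<rightarrow>\<^sub>M M\<^sub>2" and "X\<^sub>3 \<in> P \<rightarrow>\<^sub>M M\<^sub>3"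
    and "cond_distr P M\<^sub>1 X\<^sub>1 M\<^sub>3 X\<^sub>3 K\<^sub>1"
    and "cond_distr P M\<^sub>2 X\<^sub>2 M\<^sub>3 X\<^sub>3 K\<^sub>2"
    and "cond_distr P (M\<^sub>1 \<Otimes>\<^sub>M M\<^sub>2) (\<lambda>\<omega>. (X\<^sub>1 \<omega>, X\<^sub>2 \<omega>)) M\<^sub>3 X\<^sub>3 K\<^sub>1\<^sub>2"
    and "cond_indep (distr P M\<^sub>3 X\<^sub>3) M\<^sub>1 M\<^sub>2 K\<^sub>1 K\<^sub>2 K\<^sub>1\<^sub>2"
  shows "indep_rv P M\<^sub>1 X\<^sub>1 M\<^sub>2 X\<^sub>2 \<longleftrightarrow> kernel_indep (distr P M\<^sub>3 X\<^sub>3) K\<^sub>1 K\<^sub>2"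
proof -
  interpret P: prob_space P by fact
  let ?Q = "distr P M\<^sub>3 X\<^sub>3"
  have Q: "prob_space ?Q"
    by (rule P.prob_space_distr) fact
  have mk: "markov_kernel ?Q M\<^sub>1 K\<^sub>1" "markov_kernel ?Q M\<^sub>2 K\<^sub>2"
      "markov_kernel ?Q (M\<^sub>1 \<Otimes>\<^sub>M M\<^sub>2) K\<^sub>1\<^sub>2"
    using assms(5-7) by (simp_all add: cond_distr_def markov_kernel_cong_sets[of ?Q M\<^sub>3])
  have img: "kernel_image ?Q K\<^sub>1 = distr P M\<^sub>1 X\<^sub>1" "kernel_image ?Q K\<^sub>2 = distr P M\<^sub>2 X\<^sub>2"
      "kernel_image ?Q K\<^sub>1\<^sub>2 = distr P (M\<^sub>1 \<Otimes>\<^sub>M M\<^sub>2) (\<lambda>\<omega>. (X\<^sub>1 \<omega>, X\<^sub>2 \<omega>))"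
    using assms(1-7) by (auto intro!: kernel_image_cond_distr)
  show ?thesis
    unfolding indep_rv_iff_distr[OF assms(1-3)] kernel_indep_iff[OF Q mk(1,2)]
    by (simp add: cond_indep_emeasure_kernel_image[OF Q mk assms(8)] img)
qed

end
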